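(* The following are equivalent for a trunc $G$. (1) $G$ is hyperarchimedean and has enough unital components. (2) $G$ is hyperarchimedean and bounded away from $\infty$. (3) $G$ is simple.
   Context: All vector lattices are real. A truncation on an archimedean vector lattice $G$ is a unary operation $g\mapsto\overline g$ on $G^+$ such that for all $g,h\in G^+$: $g\wedge\overline h\le\overline g\le g$; if $\overline g=0$ then $g=0$; if $ng=\overline{ng}$ for all positive integers $n$ then $g=0$. A trunc is an archimedean vector lattice with a truncation. $\overline G=\{\overline g:g\in G^+\}$; for $h\in G^+$, $h\ominus1$ denotes $h-\overline h$. For $f,g\in G^+$, $f$ is a component of $g$ if $f\le g$ and $f\wedge(g-f)=0$. A unital component of $G$ is an element $u\in\overline G$ such that $u\wedge g$ is a component of $g$ for every $g\in\overline G$; $\mathcal{UC}(G)$ is the set of unital components. $G$ is simple if every element is a finite real linear combination of unital components. $G$ has enough unital components if for every $g\in G^+$ there is $u\in\mathcal{UC}(G)$ with $\overline g\le u$. $G$ is bounded away from $\infty$ if for every $g\in G^+$ there is $h\in G^+$ with $\overline g\le h\ominus1$. $G$ is hyperarchimedean if for every $g\in G^+$ the convex $\ell$-subgroup $G(g)$ generated by $g$ is a cardinal summand: every $f\in G$ can be written uniquely as $f=f_g+f'$ with $f_g\in G(g)$ and $f'\in g^\perp=\{k\in G:|k|\wedge g=0\}$ (equivalently, $G/K$ is archimedean for every convex $\ell$-subgroup $K$). *)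

theory Defs
  imports Complex_Main "HOL-Library.Lattice_Algebras"
begin

class vector_lattice = ordered_real_vector + lattice_ab_group_add_abs

class archimedean_vector_lattice = vector_lattice +
  assumes archimedean: "0 \<le> x \<Longrightarrow> 0 \<le> y \<Longrightarrow> (\<And>n::nat. real n *\<^sub>R x \<le> y) \<Longrightarrow> x = 0"

text \<open>
  A truncation is a unary operation on the positive cone.  It is represented by a function on the
  whole type; its values outside the positive cone are unconstrained and never used below.
  A trunc is a type of class \<open>archimedean_vector_lattice\<close> together with such a function.
\<close>

locale truncation =
  fixes tr :: "'a::archimedean_vector_lattice \<Rightarrow> 'a"
  assumes trunc_nonneg: "0 \<le> g \<Longrightarrow> 0 \<le> tr g"
    and inf_trunc_le: "0 \<le> g \<Longrightarrow> 0 \<le> h \<Longrightarrow> inf g (tr h) \<le> tr g"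
    and trunc_le: "0 \<le> g \<Longrightarrow> tr g \<le> g"
    and trunc_eq_0: "0 \<le> g \<Longrightarrow> tr g = 0 \<Longrightarrow> g = 0"
    and trunc_fixed_multiples:
      "0 \<le> g \<Longrightarrow> (\<And>n::nat. 0 < n \<Longrightarrow> real n *\<^sub>R g = tr (real n *\<^sub>R g)) \<Longrightarrow> g = 0"

definition trunc_range :: "('a::archimedean_vector_lattice \<Rightarrow> 'a) \<Rightarrow> 'a set"
  where "trunc_range tr = tr ` {g. 0 \<le> g}"

text \<open>\<open>ominus_one tr h\<close> is $h \ominus 1$.\<close>

definition ominus_one :: "('a::archimedean_vector_lattice \<Rightarrow> 'a) \<Rightarrow> 'a \<Rightarrow> 'a"
  where "ominus_one tr h = h - tr h"

definition is_component :: "'a::vector_lattice \<Rightarrow> 'a \<Rightarrow> bool"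
  where "is_component f g \<longleftrightarrow> 0 \<le> f \<and> 0 \<le> g \<and> f \<le> g \<and> inf f (g - f) = 0"

definition unital_components :: "('a::archimedean_vector_lattice \<Rightarrow> 'a) \<Rightarrow> 'a set"
  where "unital_components tr =
    {u \<in> trunc_range tr. \<forall>g\<in>trunc_range tr. is_component (inf u g) g}"

definition simple_trunc :: "('a::archimedean_vector_lattice \<Rightarrow> 'a) \<Rightarrow> bool"
  where "simple_trunc tr \<longleftrightarrow> (\<forall>g. g \<in> span (unital_components tr))"

definition enough_unital_components :: "('a::archimedean_vector_lattice \<Rightarrow> 'a) \<Rightarrow> bool"
  where "enough_unital_components tr \<longleftrightarrow> (\<forall>g\<ge>0. \<exists>u\<in>unital_components tr. tr g \<le> u)"

definition bounded_away_from_infinity :: "('a::archimedean_vector_lattice \<Rightarrow> 'a) \<Rightarrow> bool"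
  where "bounded_away_from_infinity tr \<longleftrightarrow> (\<forall>g\<ge>0. \<exists>h\<ge>0. tr g \<le> ominus_one tr h)"

definition convex_l_subgroup :: "'a::vector_lattice set \<Rightarrow> bool"
  where "convex_l_subgroup K \<longleftrightarrow>
    0 \<in> K \<and> (\<forall>x\<in>K. \<forall>y\<in>K. x + y \<in> K) \<and> (\<forall>x\<in>K. - x \<in> K) \<and>
    (\<forall>x\<in>K. \<forall>y\<in>K. sup x y \<in> K \<and> inf x y \<in> K) \<and>
    (\<forall>x\<in>K. \<forall>y\<in>K. \<forall>z. x \<le> z \<and> z \<le> y \<longrightarrow> z \<in> K)"

definition generated_convex_l_subgroup :: "'a::vector_lattice \<Rightarrow> 'a set"
  where "generated_convex_l_subgroup g = convex_l_subgroup hull {g}"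

definition polar :: "'a::vector_lattice \<Rightarrow> 'a set"
  where "polar g = {k. inf \<bar>k\<bar> g = 0}"

text \<open>A property of the vector lattice alone, independent of any truncation.\<close>

definition hyperarchimedean :: "'a::vector_lattice itself \<Rightarrow> bool"
  where "hyperarchimedean _ \<longleftrightarrow>
    (\<forall>g::'a. 0 \<le> g \<longrightarrow>
      (\<forall>f. \<exists>!p \<in> generated_convex_l_subgroup g \<times> polar g. f = fst p + snd p))"

end

theory Submission
  imports Defs
begin

text \<open>
  Think of \<open>G\<close> as functions with \<open>tr g = g \<sqinter> 1\<close>; unital components are then indicator functions.
  If \<open>G\<close> is simple, any unital component splits into finitely many pieces on each of which a given
  \<open>g\<close> is constant; each piece lies in \<open>G(g)\<close> or in the polar of \<open>g\<close>.
  If \<open>G\<close> is hyperarchimedean and \<open>tr g \<le> h \<ominus> 1\<close>, the projection of \<open>tr h\<close> onto \<open>G(h \<ominus> 1)\<close> is a unital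
  component above \<open>tr g\<close>.  Finally, a positive \<open>g\<close> in a hyperarchimedean \<open>G\<close> with enough unital
  components lies below a multiple of some unital component \<open>u\<close>, and \<open>t \<mapsto> g \<sqinter> t u\<close> is locally
  piecewise linear with slopes spanned by components of \<open>u\<close>; compactness then writes \<open>g\<close> as a finite
  combination of such slopes.
\<close>

section \<open>Disjointness in vector lattices\<close>

text \<open>Distributing the sum of the two meets gives the meet of \<open>x + x\<close>,
  \<open>y + x\<close>, \<open>x + z\<close> and \<open>y + z\<close>; positivity puts each of the
  first three above \<open>x\<close>.\<close>

lemma inf_add_le:
  fixes x y z :: "'a::lattice_ab_group_add"
  assumes "0 \<le> x" "0 \<le> y" "0 \<le> z"
  shows "inf x (y + z) \<le> inf x y + inf x z"
proof -
  have "inf x y + inf x z = inf (inf (x + x) (y + x)) (inf (x + z) (y + z))"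
    by (simp add: add_inf_distrib_left add_inf_distrib_right)
  moreover have "inf x (y + z) \<le> \<dots>"
    using assms by (intro le_infI le_infI1[of x] le_infI2) (auto simp: add_increasing add_increasing2)
  ultimately show ?thesis by simp
qed

lemma disjoint_mono:
  fixes x y :: "'a::lattice_ab_group_add"
  assumes "inf x y = 0" "0 \<le> x'" "x' \<le> x" "0 \<le> y'" "y' \<le> y"
  shows "inf x' y' = 0"
  using inf_mono[OF assms(3,5)] assms by (intro order.antisym) auto

lemma disjoint_add:
  fixes x y z :: "'a::lattice_ab_group_add"
  assumes "inf x y = 0" "inf x z = 0"
  shows "inf x (y + z) = 0"
proof -
  have "0 \<le> x" "0 \<le> y" "0 \<le> z"
    using assms by (metis inf.cobounded1 inf.cobounded2)+
  then show ?thesis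
    using inf_add_le[of x y z] assms by (intro order.antisym) auto
qed

lemma disjoint_positive_parts:
  fixes a b :: "'a::lattice_ab_group_add"
  shows "inf (a - inf a b) (b - inf a b) = 0"
  using add_inf_distrib_right[of a b "- inf a b"]
  by (simp only: add_uminus_conv_diff diff_self)

lemma diff_inf_eq_pos_part:
  fixes x u :: "'a::lattice_ab_group_add"
  shows "x - inf u x = sup (x - u) 0"
  by (simp add: diff_inf_eq_sup add_sup_distrib_left)

text \<open>From \<open>0 \<le> p + q\<close> comes \<open>- p \<le> q\<close>, and always
  \<open>- p \<le> \<bar>p\<bar>\<close>, so \<open>- p\<close> lies below a meet that is
  \<open>0\<close>.\<close>

lemma disjoint_summands_nonneg:
  fixes p q :: "'a::lattice_ab_group_add_abs"
  assumes "inf \<bar>p\<bar> \<bar>q\<bar> = 0" "0 \<le> p + q"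
  shows "0 \<le> p"
proof -
  have "- p \<le> \<bar>q\<bar>"
    using assms(2) abs_ge_self[of q] by (metis add.commute diff_0 diff_le_eq order.trans)
  then have "- p \<le> inf \<bar>p\<bar> \<bar>q\<bar>"
    by (simp add: abs_ge_minus_self)
  then show ?thesis using assms(1) by simp
qed

section \<open>Scalar multiples, disjointness and meets\<close>

lemma scaleR_inf_distrib:
  fixes x y :: "'a::vector_lattice"
  assumes "0 \<le> c"
  shows "c *\<^sub>R inf x y = inf (c *\<^sub>R x) (c *\<^sub>R y)"
proof (cases "c = 0")
  case False
  then have c: "0 < c" using assms by simp
  show ?thesis
  proof (rule order.antisym)
    show "c *\<^sub>R inf x y \<le> inf (c *\<^sub>R x) (c *\<^sub>R y)"
      using assms by (auto intro: scaleR_left_mono)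
    have "inverse c *\<^sub>R inf (c *\<^sub>R x) (c *\<^sub>R y) \<le> inverse c *\<^sub>R (c *\<^sub>R x)"
      "inverse c *\<^sub>R inf (c *\<^sub>R x) (c *\<^sub>R y) \<le> inverse c *\<^sub>R (c *\<^sub>R y)"
      using assms by (auto intro!: scaleR_left_mono simp del: scaleR_scaleR)
    then have "inverse c *\<^sub>R inf (c *\<^sub>R x) (c *\<^sub>R y) \<le> inf x y"
      using c by simp
    from scaleR_left_mono[OF this assms] show "inf (c *\<^sub>R x) (c *\<^sub>R y) \<le> c *\<^sub>R inf x y"
      using c by simp
  qed
qed simp

lemma disjoint_scaleR:
  fixes x y :: "'a::vector_lattice"
  assumes "inf x y = 0" "0 \<le> c"
  shows "inf (c *\<^sub>R x) y = 0"
proof -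
  have xy: "0 \<le> x" "0 \<le> y" using assms(1) by (metis inf.cobounded1 inf.cobounded2)+
  \<comment> \<open>A common factor keeps the meet \<open>0\<close>, and \<open>max 1 c\<close> is
    large enough to dominate both \<open>c *\<^sub>R x\<close> and \<open>y\<close>.\<close>
  have "inf (max 1 c *\<^sub>R x) (max 1 c *\<^sub>R y) = 0"
    using assms by (simp flip: scaleR_inf_distrib)
  then show ?thesis
    by (rule disjoint_mono)
      (use xy assms(2) scaleR_right_mono[of c "max 1 c" x] scaleR_right_mono[of 1 "max 1 c" y]
        in \<open>auto simp: scaleR_nonneg_nonneg\<close>)
qed

lemma abs_scaleR_le:
  fixes x :: "'a::vector_lattice"
  shows "\<bar>c *\<^sub>R x\<bar> \<le> \<bar>c\<bar> *\<^sub>R \<bar>x\<bar>"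
proof (cases "0 \<le> c")
  case True
  then show ?thesis
    using scaleR_left_mono[OF abs_ge_self[of x], of c] scaleR_left_mono[OF abs_ge_minus_self[of x], of c]
    by (intro abs_leI) auto
next
  case False
  then show ?thesis
    using scaleR_left_mono[OF abs_ge_self[of x], of "- c"] scaleR_left_mono[OF abs_ge_minus_self[of x], of "- c"]
    by (intro abs_leI) auto
qed

lemma le_disjoint_scaleR_imp_eq_0:
  fixes x y :: "'a::vector_lattice"
  assumes "inf x \<bar>y\<bar> = 0" "x \<le> c *\<^sub>R y"
  shows "x = 0"
proof -
  have x: "0 \<le> x" using assms(1) by (metis inf.cobounded1)
  have "x \<le> \<bar>c\<bar> *\<^sub>R \<bar>y\<bar>"
    using assms(2) abs_ge_self[of "c *\<^sub>R y"] abs_scaleR_le[of c y] by (meson order.trans)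
  moreover have "inf x (\<bar>c\<bar> *\<^sub>R \<bar>y\<bar>) = 0"
    using disjoint_scaleR[of "\<bar>y\<bar>" x "\<bar>c\<bar>"] assms(1) by (simp add: inf.commute)
  ultimately show ?thesis by (simp add: inf_absorb1)
qed

text \<open>This case of distributivity comes from \<open>a + z = sup a z + inf a z\<close>: with
  \<open>z\<close> the right-hand side, \<open>sup a z \<le> sup a 0\<close> and
  \<open>inf a z \<le> inf a b\<close>.\<close>

lemma sup_inf_zero:
  fixes a b :: "'a::lattice_ab_group_add"
  assumes "0 \<le> b"
  shows "sup (inf a b) 0 = inf (sup a 0) b"
proof (rule order.antisym)
  show "sup (inf a b) 0 \<le> inf (sup a 0) b"
    using assms by (auto intro: le_infI1 le_supI1)
  define z where "z = inf (sup a 0) b"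
  have "z = sup a z + inf a z - a"
    using add_eq_inf_sup[of a z] by (simp add: algebra_simps)
  also have "\<dots> \<le> sup a 0 + inf a z - a"
    by (intro diff_right_mono add_right_mono) (auto simp: z_def)
  also have "\<dots> = sup (inf a z) (inf a z - a)"
    using add_sup_distrib_left[of "inf a z - a" a 0] by (simp add: algebra_simps)
  also have "\<dots> \<le> sup (inf a b) 0"
    by (intro sup.mono) (auto simp: z_def le_infI2)
  finally show "inf (sup a 0) b \<le> sup (inf a b) 0" by (simp only: z_def)
qed

text \<open>Apart from \<open>t - s\<close>, each form involves only one endpoint: the first suits a
  fixed \<open>s\<close> with \<open>t\<close> varying to its right, the second a fixed
  \<open>t\<close> with \<open>s\<close> varying to its left.\<close>

lemma inf_multiples_diff:
  fixes g u :: "'a::vector_lattice"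
  assumes u: "0 \<le> u" and st: "s \<le> t"
  shows "inf g (t *\<^sub>R u) - inf g (s *\<^sub>R u) = inf (sup (g - s *\<^sub>R u) 0) ((t - s) *\<^sub>R u)" (is ?right)
    and "inf g (t *\<^sub>R u) - inf g (s *\<^sub>R u) = (t - s) *\<^sub>R u - inf (sup (t *\<^sub>R u - g) 0) ((t - s) *\<^sub>R u)"
proof -
  let ?d = "(t - s) *\<^sub>R u"
  have d: "0 \<le> ?d" "?d = t *\<^sub>R u - s *\<^sub>R u"
    using assms by (simp add: scaleR_nonneg_nonneg, simp add: scaleR_left_diff_distrib)
  have "s *\<^sub>R u \<le> t *\<^sub>R u" using st u by (rule scaleR_right_mono)
  then have "inf g (s *\<^sub>R u) = inf (s *\<^sub>R u) (inf g (t *\<^sub>R u))"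
    by (metis inf.absorb1 inf.assoc inf.commute)
  then have "inf g (t *\<^sub>R u) - inf g (s *\<^sub>R u) = sup (inf g (t *\<^sub>R u) - s *\<^sub>R u) 0"
    by (simp only: diff_inf_eq_pos_part)
  also have "inf g (t *\<^sub>R u) - s *\<^sub>R u = inf (g - s *\<^sub>R u) ?d"
    using add_inf_distrib_right[of g "t *\<^sub>R u" "- (s *\<^sub>R u)"] d(2) by simp
  also have "sup \<dots> 0 = inf (sup (g - s *\<^sub>R u) 0) ?d"
    by (rule sup_inf_zero[OF d(1)])
  finally show r: ?right .
  have "?d - inf (sup (t *\<^sub>R u - g) 0) ?d = sup (?d - sup (t *\<^sub>R u - g) 0) 0"
    by (rule diff_inf_eq_pos_part)
  also have "?d - sup (t *\<^sub>R u - g) 0 = inf (g - s *\<^sub>R u) ?d"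
    using add_inf_distrib_left[of ?d "g - t *\<^sub>R u" 0] d(2) by (simp add: diff_sup_eq_inf)
  also have "sup \<dots> 0 = inf (sup (g - s *\<^sub>R u) 0) ?d"
    by (rule sup_inf_zero[OF d(1)])
  finally show "inf g (t *\<^sub>R u) - inf g (s *\<^sub>R u) = ?d - inf (sup (t *\<^sub>R u - g) 0) ?d"
    using r by simp
qed

section \<open>Principal convex subgroups and polars\<close>

lemma generated_convex_l_subgroup_eq:
  fixes g :: "'a::vector_lattice"
  assumes g: "0 \<le> g"
  shows "generated_convex_l_subgroup g = {f. \<exists>c\<ge>0. \<bar>f\<bar> \<le> c *\<^sub>R g}"
  unfolding generated_convex_l_subgroup_def
proof (rule hull_unique)
  show "{g} \<subseteq> {f. \<exists>c\<ge>0. \<bar>f\<bar> \<le> c *\<^sub>R g}"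
    using g by (auto intro!: exI[of _ 1])
  let ?K = "{f. \<exists>c\<ge>0. \<bar>f\<bar> \<le> c *\<^sub>R g}"
  \<comment> \<open>One domination property covers sums, joins, meets and intervals, since each new
    element is bounded by \<open>\<bar>x\<bar> + \<bar>y\<bar>\<close>.\<close>
  have solid: "z \<in> ?K" if xyz: "x \<in> ?K" "y \<in> ?K" "\<bar>z\<bar> \<le> \<bar>x\<bar> + \<bar>y\<bar>" for x y z
  proof -
    obtain c d where cd: "0 \<le> c" "\<bar>x\<bar> \<le> c *\<^sub>R g" "0 \<le> d" "\<bar>y\<bar> \<le> d *\<^sub>R g"
      using xyz(1,2) by auto
    have "\<bar>z\<bar> \<le> (c + d) *\<^sub>R g"
      using order.trans[OF xyz(3) add_mono[OF cd(2,4)]] by (simp add: scaleR_left_distrib)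
    then show ?thesis using cd by (auto intro!: exI[of _ "c + d"])
  qed
  have between: "\<bar>z\<bar> \<le> \<bar>x\<bar> + \<bar>y\<bar>" if "x \<le> z" "z \<le> y" for x y z :: 'a
  proof (rule abs_leI)
    show "z \<le> \<bar>x\<bar> + \<bar>y\<bar>"
      using that by (meson abs_ge_self abs_ge_zero add_increasing order.trans)
    show "- z \<le> \<bar>x\<bar> + \<bar>y\<bar>"
      using that by (meson abs_ge_minus_self abs_ge_zero add_increasing2 le_imp_neg_le order.trans)
  qed
  have supb: "\<bar>sup x y\<bar> \<le> \<bar>x\<bar> + \<bar>y\<bar>" for x y :: 'a
  proof (rule abs_leI)
    show "sup x y \<le> \<bar>x\<bar> + \<bar>y\<bar>"
      by (auto intro: add_increasing add_increasing2 abs_ge_self)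
    have "- sup x y \<le> - x" by simp
    then show "- sup x y \<le> \<bar>x\<bar> + \<bar>y\<bar>"
      by (meson abs_ge_minus_self abs_ge_zero add_increasing2 order.trans)
  qed
  have infb: "\<bar>inf x y\<bar> \<le> \<bar>x\<bar> + \<bar>y\<bar>" for x y :: 'a
    using supb[of "- x" "- y"] by (simp flip: neg_inf_eq_sup)
  show "convex_l_subgroup {f. \<exists>c\<ge>0. \<bar>f\<bar> \<le> c *\<^sub>R g}"
    unfolding convex_l_subgroup_def
  proof (intro conjI ballI allI impI)
    show "0 \<in> ?K" by (auto intro!: exI[of _ 0])
    fix x assume x: "x \<in> ?K"
    then show "- x \<in> ?K" by simp
    fix y assume y: "y \<in> ?K"
    show "x + y \<in> ?K" by (rule solid[OF x y abs_triangle_ineq])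
    show "sup x y \<in> ?K" by (rule solid[OF x y supb])
    show "inf x y \<in> ?K" by (rule solid[OF x y infb])
    fix z assume "x \<le> z \<and> z \<le> y"
    then show "z \<in> ?K" by (intro solid[OF x y between]) auto
  qed
next
  fix K :: "'a set"
  assume gK: "{g} \<subseteq> K" and K: "convex_l_subgroup K"
  \<comment> \<open>Closure under addition yields only natural multiples of \<open>g\<close>, but
    these dominate every real multiple.\<close>
  have mult: "real n *\<^sub>R g \<in> K" for n
  proof (induction n)
    case 0
    show ?case using K by (simp add: convex_l_subgroup_def)
  next
    case (Suc n)
    then have "g + real n *\<^sub>R g \<in> K"
      using gK K unfolding convex_l_subgroup_def by blast
    then show ?case by (simp add: scaleR_left_distrib add.commute)
  qed
  show "{f. \<exists>c\<ge>0. \<bar>f\<bar> \<le> c *\<^sub>R g} \<subseteq> K"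
  proof safe
    fix f :: 'a and c :: real
    assume f: "\<bar>f\<bar> \<le> c *\<^sub>R g"
    obtain n where "c \<le> real n" using real_arch_simple by blast
    then have "\<bar>f\<bar> \<le> real n *\<^sub>R g" using f scaleR_right_mono[OF _ g] by (meson order.trans)
    then have "f \<le> real n *\<^sub>R g" "- (real n *\<^sub>R g) \<le> f"
      by (auto dest: abs_le_D1 abs_le_D2 simp: minus_le_iff)
    then show "f \<in> K"
      using K mult[of n] unfolding convex_l_subgroup_def by meson
  qed
qed

lemma subspace_generated_convex_l_subgroup:
  fixes g :: "'a::vector_lattice"
  assumes "0 \<le> g"
  shows "subspace (generated_convex_l_subgroup g)"
  unfolding generated_convex_l_subgroup_eq[OF assms]
proof (rule subspaceI; clarsimp)
  fix x y :: 'a and c d :: real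
  assume "0 \<le> c" "\<bar>x\<bar> \<le> c *\<^sub>R g" "0 \<le> d" "\<bar>y\<bar> \<le> d *\<^sub>R g"
  then show "\<exists>c\<ge>0. \<bar>x + y\<bar> \<le> c *\<^sub>R g"
    using order.trans[OF abs_triangle_ineq add_mono]
    by (intro exI[of _ "c + d"]) (auto simp: scaleR_left_distrib)
next
  fix r c :: real and x :: 'a
  assume "0 \<le> c" "\<bar>x\<bar> \<le> c *\<^sub>R g"
  then show "\<exists>c\<ge>0. \<bar>r *\<^sub>R x\<bar> \<le> c *\<^sub>R g"
    using order.trans[OF abs_scaleR_le scaleR_left_mono, of x "c *\<^sub>R g" r]
    by (intro exI[of _ "\<bar>r\<bar> * c"]) auto
qed auto

lemma subspace_polar:
  fixes g :: "'a::vector_lattice"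
  assumes "0 \<le> g"
  shows "subspace (polar g)"
proof (rule subspaceI; clarsimp simp: polar_def)
  show "inf 0 g = 0" using assms by (simp add: inf_absorb1)
next
  fix x y :: 'a
  assume "inf \<bar>x\<bar> g = 0" "inf \<bar>y\<bar> g = 0"
  then have "inf g (\<bar>x\<bar> + \<bar>y\<bar>) = 0" by (intro disjoint_add) (auto simp: inf.commute)
  from disjoint_mono[OF this assms order.refl abs_ge_zero abs_triangle_ineq]
  show "inf \<bar>x + y\<bar> g = 0" by (simp add: inf.commute)
next
  fix c :: real and x :: 'a
  assume "inf \<bar>x\<bar> g = 0"
  then have "inf (\<bar>c\<bar> *\<^sub>R \<bar>x\<bar>) g = 0" by (rule disjoint_scaleR) simp
  then show "inf \<bar>c *\<^sub>R x\<bar> g = 0"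
    by (rule disjoint_mono) (use assms abs_scaleR_le in auto)
qed

lemma generated_inter_polar:
  fixes g :: "'a::vector_lattice"
  assumes g: "0 \<le> g" and "z \<in> generated_convex_l_subgroup g" "z \<in> polar g"
  shows "z = 0"
proof -
  obtain c where "\<bar>z\<bar> \<le> c *\<^sub>R g" and "inf \<bar>z\<bar> g = 0"
    using assms by (auto simp: generated_convex_l_subgroup_eq polar_def)
  then have "\<bar>z\<bar> = 0"
    using le_disjoint_scaleR_imp_eq_0[of "\<bar>z\<bar>" g c] g by simp
  then show ?thesis by simp
qed

section \<open>Projections in hyperarchimedean vector lattices\<close>

lemma hyperarchimedeanI:
  assumes "\<And>g f :: 'a::vector_lattice. 0 \<le> g \<Longrightarrow>
    \<exists>p\<in>generated_convex_l_subgroup g. \<exists>q\<in>polar g. f = p + q"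
  shows "hyperarchimedean TYPE('a)"
  unfolding hyperarchimedean_def
proof (intro allI impI)
  fix g f :: 'a
  assume g: "0 \<le> g"
  from assms[OF g] obtain p q
    where pq: "p \<in> generated_convex_l_subgroup g" "q \<in> polar g" "f = p + q" by blast
  have "p' = p \<and> q' = q"
    if "p' \<in> generated_convex_l_subgroup g" "q' \<in> polar g" "f = p' + q'" for p' q'
  proof -
    \<comment> \<open>Uniqueness is automatic: the difference of two decompositions lies in both
      summands, which share only \<open>0\<close>.\<close>
    have eq: "p' - p = q - q'" using that pq by (metis add_diff_eq diff_add_cancel diff_diff_eq2 add.commute)
    have "p' - p \<in> generated_convex_l_subgroup g"
      using subspace_diff[OF subspace_generated_convex_l_subgroup[OF g]] that pq by blast
    moreover have "p' - p \<in> polar g"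
      unfolding eq using subspace_diff[OF subspace_polar[OF g]] that pq by blast
    ultimately have "p' - p = 0" using generated_inter_polar[OF g] by blast
    then show ?thesis using eq by simp
  qed
  then show "\<exists>!r. r \<in> generated_convex_l_subgroup g \<times> polar g \<and> f = fst r + snd r"
    using pq by (intro ex1I[of _ "(p, q)"]) auto
qed

text \<open>The two parts of \<open>u\<close> are disjoint, so positivity of their sum passes to
  each of them.\<close>

lemma hyperarchimedean_projection:
  fixes u g :: "'a::vector_lattice"
  assumes "hyperarchimedean TYPE('a)" "0 \<le> g" "0 \<le> u"
  obtains p q c where "u = p + q" "0 \<le> p" "0 \<le> q" "0 \<le> c" "p \<le> c *\<^sub>R g" "inf q g = 0" "inf p q = 0"
proof -
  obtain p q where pq: "p \<in> generated_convex_l_subgroup g" "q \<in> polar g" "u = p + q"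
  proof -
    have "\<exists>!p. p \<in> generated_convex_l_subgroup g \<times> polar g \<and> u = fst p + snd p"
      using assms unfolding hyperarchimedean_def by blast
    then show thesis using that by (auto elim!: ex1E)
  qed
  obtain c where c: "0 \<le> c" "\<bar>p\<bar> \<le> c *\<^sub>R g" and q: "inf \<bar>q\<bar> g = 0"
    using pq assms(2) by (auto simp: generated_convex_l_subgroup_eq polar_def)
  have "inf (c *\<^sub>R g) \<bar>q\<bar> = 0"
    using disjoint_scaleR[of g "\<bar>q\<bar>" c] q c by (simp add: inf.commute)
  then have dj: "inf \<bar>p\<bar> \<bar>q\<bar> = 0"
    by (rule disjoint_mono) (use c in auto)
  have "0 \<le> p"
    using disjoint_summands_nonneg[OF dj] pq(3) assms(3) by simp
  have "inf \<bar>q\<bar> \<bar>p\<bar> = 0" using dj by (simp only: inf.commute)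
  then have "0 \<le> q"
    using disjoint_summands_nonneg[of q p] pq(3) assms(3) by (simp only: add.commute)
  note abs = abs_of_nonneg[OF \<open>0 \<le> p\<close>] abs_of_nonneg[OF \<open>0 \<le> q\<close>]
  show ?thesis
    by (rule that[OF pq(3) \<open>0 \<le> p\<close> \<open>0 \<le> q\<close> c(1) c(2)[unfolded abs] q[unfolded abs] dj[unfolded abs]])
qed

text \<open>Take for \<open>p\<close> the projection of \<open>u\<close> onto the convex subgroup of
  \<open>x\<close>, with \<open>p \<le> c *\<^sub>R x\<close>. Once \<open>d * c \<le> 1\<close>,
  the multiple \<open>d *\<^sub>R p\<close> fits below \<open>x\<close>, while the rest of
  \<open>d *\<^sub>R u\<close> is disjoint from \<open>x\<close>.\<close>

lemma hyperarchimedean_inf_small_multiple: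
  fixes u x :: "'a::vector_lattice"
  assumes "hyperarchimedean TYPE('a)" "0 \<le> x" "0 \<le> u"
  obtains p \<delta> where "is_component p u" "0 < \<delta>" "\<And>d. 0 \<le> d \<Longrightarrow> d < \<delta> \<Longrightarrow> inf x (d *\<^sub>R u) = d *\<^sub>R p"
proof -
  obtain p q c where pq: "u = p + q" "0 \<le> p" "0 \<le> q" "0 \<le> c" "p \<le> c *\<^sub>R x" "inf q x = 0" "inf p q = 0"
    by (rule hyperarchimedean_projection[OF assms])
  \<comment> \<open>The \<open>+ 1\<close> keeps the radius positive when \<open>c = 0\<close>,
    where \<open>inverse c\<close> would be \<open>0\<close>.\<close>
  have "inf x (d *\<^sub>R u) = d *\<^sub>R p" if d: "0 \<le> d" "d < inverse (c + 1)" for d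
  proof (rule order.antisym)
    have "d * c \<le> d * (c + 1)" using d by (simp add: mult_left_mono)
    also have "\<dots> \<le> 1" using d pq(4) by (simp add: field_simps)
    finally have dc: "d * c \<le> 1" .
    have "inf x (d *\<^sub>R q) = 0"
      using disjoint_scaleR[OF pq(6) d(1)] by (simp add: inf.commute)
    moreover have "inf x (d *\<^sub>R p + d *\<^sub>R q) \<le> inf x (d *\<^sub>R p) + inf x (d *\<^sub>R q)"
      using pq d assms(2) by (intro inf_add_le) (auto simp: scaleR_nonneg_nonneg)
    ultimately show "inf x (d *\<^sub>R u) \<le> d *\<^sub>R p"
      using pq(1) by (simp add: scaleR_right_distrib)
    have "d *\<^sub>R p \<le> (d * c) *\<^sub>R x"
      using scaleR_left_mono[OF pq(5) d(1)] by simp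
    also have "\<dots> \<le> x" using scaleR_right_mono[OF dc assms(2)] by simp
    finally show "d *\<^sub>R p \<le> inf x (d *\<^sub>R u)"
      using pq d by (auto intro!: scaleR_left_mono)
  qed
  moreover have "is_component p u"
    using pq by (auto simp: is_component_def)
  ultimately show ?thesis using that[of p "inverse (c + 1)"] pq(4) by auto
qed

section \<open>Unital components\<close>

context truncation
begin

section \<open>The range of the truncation\<close>

lemma trunc_mono:
  assumes "0 \<le> g" "g \<le> h"
  shows "tr g \<le> tr h"
proof -
  have "tr g \<le> h" using trunc_le[of g] assms by auto
  then show ?thesis using inf_trunc_le[of h g] assms by (simp add: inf_absorb2)
qed

text \<open>For \<open>y\<close> below some \<open>tr h\<close>, the axiom
  \<open>inf_trunc_le\<close> reads \<open>y \<le> tr y\<close>.\<close>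

lemma trunc_range_downward:
  assumes "x \<in> trunc_range tr" "0 \<le> y" "y \<le> x"
  shows "tr y = y"
proof -
  obtain h where "0 \<le> h" "x = tr h" using assms(1) by (auto simp: trunc_range_def)
  then show ?thesis
    using inf_trunc_le[of y h] trunc_le[of y] assms by (auto simp: inf_absorb1)
qed

lemma trunc_range_nonneg: "x \<in> trunc_range tr \<Longrightarrow> 0 \<le> x"
  using trunc_nonneg by (auto simp: trunc_range_def)

lemma trunc_range_fixed: "x \<in> trunc_range tr \<Longrightarrow> tr x = x"
  using trunc_range_downward trunc_range_nonneg by blast

lemma fixed_in_trunc_range: "0 \<le> x \<Longrightarrow> tr x = x \<Longrightarrow> x \<in> trunc_range tr"
  by (force simp: trunc_range_def)

lemma trunc_in_trunc_range: "0 \<le> x \<Longrightarrow> tr x \<in> trunc_range tr"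
  by (auto simp: trunc_range_def)

lemma trunc_range_downward_closed:
  "x \<in> trunc_range tr \<Longrightarrow> 0 \<le> y \<Longrightarrow> y \<le> x \<Longrightarrow> y \<in> trunc_range tr"
  using trunc_range_downward fixed_in_trunc_range by blast

lemma trunc_range_sup:
  assumes "x \<in> trunc_range tr" "y \<in> trunc_range tr"
  shows "sup x y \<in> trunc_range tr"
proof (rule fixed_in_trunc_range)
  show nn: "0 \<le> sup x y" using trunc_range_nonneg[OF assms(1)] by (simp add: le_supI1)
  show "tr (sup x y) = sup x y"
    using trunc_mono[of x "sup x y"] trunc_mono[of y "sup x y"] trunc_le[OF nn]
      assms[THEN trunc_range_fixed] assms[THEN trunc_range_nonneg]
    by (intro order.antisym) auto
qed

text \<open>The positive part of \<open>x - u\<close> equals \<open>x - inf u x\<close>, the excess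
  of \<open>x\<close> over \<open>u\<close>. It lies below \<open>x\<close>, so meeting it with
  \<open>inf u x\<close> is the same as meeting it with \<open>u\<close>.\<close>

lemma unital_components_iff:
  "u \<in> unital_components tr \<longleftrightarrow>
    u \<in> trunc_range tr \<and> (\<forall>x\<in>trunc_range tr. inf u (sup (x - u) 0) = 0)"
proof -
  have "is_component (inf u x) x \<longleftrightarrow> inf u (sup (x - u) 0) = 0"
    if "u \<in> trunc_range tr" "x \<in> trunc_range tr" for x
  proof -
    have nn: "0 \<le> u" "0 \<le> x" using that trunc_range_nonneg by auto
    have "inf x (sup (x - u) 0) = sup (x - u) 0"
      using nn by (intro inf_absorb2) auto
    then have "inf (inf u x) (x - inf u x) = inf u (sup (x - u) 0)"
      by (simp only: diff_inf_eq_pos_part inf.assoc)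
    then show ?thesis using nn by (simp add: is_component_def)
  qed
  then show ?thesis by (auto simp: unital_components_def)
qed

lemma unital_components_nonneg: "u \<in> unital_components tr \<Longrightarrow> 0 \<le> u"
  by (auto simp: unital_components_iff trunc_range_nonneg)

lemma zero_unital_component: "0 \<in> unital_components tr"
proof -
  have "tr 0 = 0" using trunc_le[of 0] trunc_nonneg[of 0] by simp
  then have "0 \<in> trunc_range tr" using fixed_in_trunc_range by force
  then show ?thesis by (auto simp: unital_components_iff inf_absorb1 le_supI2)
qed

text \<open>The excess of \<open>x\<close> over \<open>p\<close> is at most its excess over
  \<open>u\<close> plus \<open>u - p\<close>, and both are disjoint from \<open>p\<close>.\<close>

lemma component_of_unital:
  assumes u: "u \<in> unital_components tr" and p: "is_component p u"
  shows "p \<in> unital_components tr"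
  unfolding unital_components_iff
proof (intro conjI ballI)
  have p': "0 \<le> p" "p \<le> u" "inf p (u - p) = 0" using p by (auto simp: is_component_def)
  show "p \<in> trunc_range tr"
    using u p' trunc_range_downward_closed by (auto simp: unital_components_iff)
  fix x assume "x \<in> trunc_range tr"
  then have "inf u (sup (x - u) 0) = 0" using u by (auto simp: unital_components_iff)
  then have "inf p (sup (x - u) 0) = 0"
    by (rule disjoint_mono) (use p' in auto)
  then have *: "inf p (sup (x - u) 0 + (u - p)) = 0" using p' by (intro disjoint_add)
  have "sup (x - p) 0 \<le> sup (x - u) 0 + (u - p)"
    using p' by (auto simp: add_sup_distrib_right intro: le_supI2)
  from disjoint_mono[OF * p'(1) order.refl _ this]
  show "inf p (sup (x - p) 0) = 0" by simp
qed

lemma unital_components_inf_component: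
  assumes "u \<in> unital_components tr" "w \<in> unital_components tr"
  shows "is_component (inf u w) w"
  using assms by (auto simp: unital_components_def)

lemma component_complement: "is_component p u \<Longrightarrow> is_component (u - p) u"
  by (auto simp: is_component_def inf.commute)

text \<open>The excess over \<open>sup u v\<close> is below the excesses over \<open>u\<close> and
  over \<open>v\<close>, hence disjoint from \<open>u + v\<close>, which dominates
  \<open>sup u v\<close>.\<close>

lemma unital_components_sup:
  assumes u: "u \<in> unital_components tr" and v: "v \<in> unital_components tr"
  shows "sup u v \<in> unital_components tr"
  unfolding unital_components_iff
proof (intro conjI ballI)
  show "sup u v \<in> trunc_range tr" using assms trunc_range_sup by (auto simp: unital_components_iff)
  fix x assume x: "x \<in> trunc_range tr"
  let ?z = "sup (x - sup u v) 0"
  have nn: "0 \<le> u" "0 \<le> v" using assms unital_components_nonneg by auto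
  have le: "x - sup u v \<le> x - u" "x - sup u v \<le> x - v"
    by (simp_all add: diff_left_mono del: diff_sup_eq_inf)
  have "inf u ?z = 0"
    by (rule disjoint_mono[of u "sup (x - u) 0"])
      (use u x nn in \<open>auto simp: unital_components_iff simp del: diff_sup_eq_inf intro!: le_supI1 le\<close>)
  moreover have "inf v ?z = 0"
    by (rule disjoint_mono[of v "sup (x - v) 0"])
      (use v x nn in \<open>auto simp: unital_components_iff simp del: diff_sup_eq_inf intro!: le_supI1 le\<close>)
  ultimately have *: "inf ?z (u + v) = 0" by (intro disjoint_add) (auto simp: inf.commute)
  have "sup u v \<le> u + v" using nn by simp
  from disjoint_mono[OF * _ order.refl _ this] show "inf (sup u v) ?z = 0"
    using nn by (simp add: inf.commute le_supI1)
qed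

text \<open>The excess of \<open>tr g\<close> over \<open>u\<close> is disjoint from
  \<open>u\<close> and yet below a multiple of \<open>u\<close>, so it vanishes.\<close>

lemma trunc_le_unital:
  assumes u: "u \<in> unital_components tr" and g: "0 \<le> g" "g \<le> c *\<^sub>R u"
  shows "tr g \<le> u"
proof -
  let ?z = "sup (tr g - u) 0"
  have nn: "0 \<le> u" "0 \<le> tr g" using u g unital_components_nonneg trunc_nonneg by auto
  have "inf u ?z = 0"
    using u g trunc_in_trunc_range by (auto simp: unital_components_iff)
  moreover have "?z \<le> tr g" using nn by auto
  then have "?z \<le> c *\<^sub>R u" using g trunc_le[OF g(1)] by (meson order.trans)
  ultimately have "?z = 0"
    using le_disjoint_scaleR_imp_eq_0[of ?z u c] nn(1)
    by (simp only: abs_of_nonneg inf.commute)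
  then have "tr g - u \<le> 0" by (metis sup.cobounded1)
  then show ?thesis by simp
qed

section \<open>From simple to bounded away from infinity\<close>

lemma span_unital_components_bounded:
  assumes "f \<in> span (unital_components tr)"
  shows "\<exists>u\<in>unital_components tr. \<exists>c\<ge>0. \<bar>f\<bar> \<le> c *\<^sub>R u"
  using assms
proof (induction rule: span_induct_alt)
  case base
  show ?case using zero_unital_component by (intro bexI[of _ 0]) auto
next
  case (step r v f)
  then obtain u c where u: "u \<in> unital_components tr" "0 \<le> c" "\<bar>f\<bar> \<le> c *\<^sub>R u" by auto
  have nn: "0 \<le> v" using step unital_components_nonneg by auto
  \<comment> \<open>Both terms are measured against the join, which is again a unital component, so
    the coefficients simply add.\<close>
  have "\<bar>r *\<^sub>R v\<bar> \<le> \<bar>r\<bar> *\<^sub>R sup v u"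
    using abs_scaleR_le[of r v] nn scaleR_left_mono[of v "sup v u" "\<bar>r\<bar>"] by auto
  moreover have "\<bar>f\<bar> \<le> c *\<^sub>R sup v u"
    using u scaleR_left_mono[of u "sup v u" c] by (meson order.trans sup.cobounded2)
  ultimately have "\<bar>r *\<^sub>R v + f\<bar> \<le> (\<bar>r\<bar> + c) *\<^sub>R sup v u"
    using order.trans[OF abs_triangle_ineq add_mono] by (simp add: scaleR_left_distrib)
  then show ?case using unital_components_sup[OF step(1) u(1)] u(2)
    by (intro bexI[of _ "sup v u"] exI[of _ "\<bar>r\<bar> + c"]) auto
qed

lemma simple_imp_enough_unital_components:
  assumes "simple_trunc tr"
  shows "enough_unital_components tr"
  unfolding enough_unital_components_def
proof (intro allI impI)
  fix g :: 'a assume g: "0 \<le> g"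
  obtain u c where "u \<in> unital_components tr" "\<bar>g\<bar> \<le> c *\<^sub>R u"
    using span_unital_components_bounded[of g] assms by (auto simp: simple_trunc_def)
  then show "\<exists>u\<in>unital_components tr. tr g \<le> u"
    using trunc_le_unital g by auto
qed

lemma enough_imp_bounded_away_from_infinity:
  assumes "enough_unital_components tr"
  shows "bounded_away_from_infinity tr"
  unfolding bounded_away_from_infinity_def
proof (intro allI impI)
  fix g :: 'a assume "0 \<le> g"
  then obtain u where u: "u \<in> unital_components tr" "tr g \<le> u"
    using assms by (auto simp: enough_unital_components_def)
  have nn: "0 \<le> u" using u unital_components_nonneg by auto
  \<comment> \<open>Doubling \<open>u\<close> gives the witness: truncation removes at most one copy
    and leaves at least the other.\<close>
  then have "tr (u + u) \<le> u"
    using trunc_le_unital[OF u(1), of "u + u" 2] by (simp add: scaleR_2)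
  then have "u \<le> ominus_one tr (u + u)" by (simp add: ominus_one_def le_diff_eq)
  then show "\<exists>h\<ge>0. tr g \<le> ominus_one tr h"
    using u(2) nn by (intro exI[of _ "u + u"]) auto
qed

section \<open>From simple to hyperarchimedean\<close>

text \<open>The elements of \<open>constancy_set f\<close> are those on which \<open>f\<close>, viewed as a function, is constant.\<close>

definition constancy_set :: "'a \<Rightarrow> 'a set"
  where "constancy_set f = {w \<in> unital_components tr. \<exists>c k. f = c *\<^sub>R w + k \<and> inf w \<bar>k\<bar> = 0}"

lemma constancy_setI:
  "w \<in> unital_components tr \<Longrightarrow> f = c *\<^sub>R w + k \<Longrightarrow> inf w \<bar>k\<bar> = 0 \<Longrightarrow> w \<in> constancy_set f"
  by (auto simp: constancy_set_def)

lemma polar_disjoint: "k \<in> polar w \<longleftrightarrow> inf w \<bar>k\<bar> = 0"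
  by (simp add: polar_def inf.commute)

text \<open>Split \<open>w\<close> into the piece \<open>a\<close> inside \<open>v\<close> and the
  piece \<open>b\<close> outside it. The new function is constant on both, with value
  \<open>r + c\<close> on \<open>a\<close> and \<open>c\<close> on \<open>b\<close>.\<close>

lemma constancy_set_refine:
  assumes v: "v \<in> unital_components tr" and w: "w \<in> constancy_set f"
  shows "w \<in> span (constancy_set (r *\<^sub>R v + f))"
proof -
  obtain c k where ck: "w \<in> unital_components tr" "f = c *\<^sub>R w + k" "k \<in> polar w"
    using w by (auto simp: constancy_set_def polar_disjoint)
  define a b where "a = inf v w" and "b = w - a"
  have nn: "0 \<le> v" "0 \<le> w" using v ck unital_components_nonneg by auto
  have comp: "is_component a w" "is_component b w"
    using unital_components_inf_component[OF v ck(1)] component_complement by (simp_all add: a_def[symmetric] b_def)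
  then have uc: "a \<in> unital_components tr" "b \<in> unital_components tr"
    using component_of_unital ck by auto
  have ab: "0 \<le> a" "0 \<le> b" "a \<le> w" "b \<le> w" "w = a + b" "inf a b = 0"
    using comp(1) by (auto simp: is_component_def b_def)
  have k: "k \<in> polar a" "k \<in> polar b"
    using ck(3) ab disjoint_mono[of w "\<bar>k\<bar>"] by (auto simp: polar_disjoint)
  have dj: "a \<in> polar b" "b \<in> polar a"
    using ab by (auto simp: polar_disjoint inf.commute)
  \<comment> \<open>Since \<open>b\<close> is below \<open>w\<close>, whatever it shares with
    \<open>v\<close> is already in \<open>a\<close>.\<close>
  have "inf b v \<le> inf a b"
    using ab(4) by (auto simp: a_def intro: le_infI1)
  then have "inf b v = 0" using ab nn by (intro order.antisym) auto
  then have vb: "v \<in> polar b"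
    using nn by (simp add: polar_disjoint)
  have "is_component a v"
    using unital_components_inf_component[OF ck(1) v] by (simp add: a_def inf.commute)
  then have va: "v - a \<in> polar a" by (auto simp: polar_disjoint is_component_def)
  have sub: "subspace (polar a)" "subspace (polar b)" using subspace_polar ab by auto
  have "c *\<^sub>R b + k + r *\<^sub>R (v - a) \<in> polar a"
    using sub(1) k dj va by (intro subspace_add subspace_scale)
  moreover have "r *\<^sub>R v + f = (r + c) *\<^sub>R a + (c *\<^sub>R b + k + r *\<^sub>R (v - a))"
    using ck(2) ab(5) by (simp add: algebra_simps)
  ultimately have A: "a \<in> constancy_set (r *\<^sub>R v + f)"
    using uc by (intro constancy_setI) (auto simp: polar_disjoint)
  have "c *\<^sub>R a + k + r *\<^sub>R v \<in> polar b"
    using sub(2) k dj vb by (intro subspace_add subspace_scale)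
  moreover have "r *\<^sub>R v + f = c *\<^sub>R b + (c *\<^sub>R a + k + r *\<^sub>R v)"
    using ck(2) ab(5) by (simp add: algebra_simps)
  ultimately have B: "b \<in> constancy_set (r *\<^sub>R v + f)"
    using uc by (intro constancy_setI) (auto simp: polar_disjoint)
  show ?thesis using span_add[OF span_base[OF A] span_base[OF B]] ab(5) by simp
qed

text \<open>Build \<open>f\<close> one term at a time: the zero function is constant on every unital
  component, and each further term splits the old pieces into sums of new ones.\<close>

lemma unital_components_in_span_constancy_set:
  assumes "f \<in> span (unital_components tr)"
  shows "unital_components tr \<subseteq> span (constancy_set f)"
  using assms
proof (induction rule: span_induct_alt)
  case base
  have "u \<in> constancy_set 0" if "u \<in> unital_components tr" for u
    using that unital_components_nonneg[OF that] by (intro constancy_setI[of u 0 0 0]) (auto simp: inf_absorb2)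
  then show ?case by (auto intro: span_base)
next
  case (step r v f)
  have "constancy_set f \<subseteq> span (constancy_set (r *\<^sub>R v + f))"
    using constancy_set_refine[OF step(1)] by blast
  then have "span (constancy_set f) \<subseteq> span (constancy_set (r *\<^sub>R v + f))"
    by (intro span_minimal) auto
  then show ?case using step(2) by blast
qed

text \<open>The value \<open>c\<close> of \<open>g\<close> on \<open>w\<close> decides: if it is
  \<open>0\<close>, then \<open>g = k\<close> is disjoint from \<open>w\<close>; otherwise
  \<open>\<bar>c\<bar> *\<^sub>R w \<le> g\<close>.\<close>

lemma constancy_set_generated_or_polar:
  assumes g: "0 \<le> g" and w: "w \<in> constancy_set g"
  shows "w \<in> generated_convex_l_subgroup g \<or> w \<in> polar g"
proof -
  obtain c k where ck: "w \<in> unital_components tr" "g = c *\<^sub>R w + k" "inf w \<bar>k\<bar> = 0"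
    using w by (auto simp: constancy_set_def)
  have nn: "0 \<le> w" using ck unital_components_nonneg by auto
  show ?thesis
  proof (cases "c = 0")
    case True
    then show ?thesis using ck g nn by (simp add: polar_def inf.commute)
  next
    case False
    have dj: "inf (\<bar>c\<bar> *\<^sub>R w) \<bar>k\<bar> = 0" using disjoint_scaleR[OF ck(3)] by simp
    have cw: "0 \<le> \<bar>c\<bar> *\<^sub>R w" using nn by (simp add: scaleR_nonneg_nonneg)
    have "\<bar>c\<bar> *\<^sub>R w \<le> \<bar>c *\<^sub>R w\<bar>"
      by (cases "0 \<le> c") (use abs_ge_self[of "c *\<^sub>R w"] abs_ge_minus_self[of "c *\<^sub>R w"] in auto)
    also have "c *\<^sub>R w = g - k" using ck by simp
    also have "\<bar>g - k\<bar> \<le> g + \<bar>k\<bar>" using abs_triangle_ineq4[of g k] g by simp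
    \<comment> \<open>Disjointness from \<open>k\<close> now removes \<open>\<bar>k\<bar>\<close>
      from the bound and leaves \<open>g\<close> alone.\<close>
    finally have "\<bar>c\<bar> *\<^sub>R w = inf (\<bar>c\<bar> *\<^sub>R w) (g + \<bar>k\<bar>)" by (simp add: inf_absorb1)
    also have "\<dots> \<le> inf (\<bar>c\<bar> *\<^sub>R w) g + inf (\<bar>c\<bar> *\<^sub>R w) \<bar>k\<bar>"
      using cw g by (intro inf_add_le) auto
    also have "\<dots> \<le> g" using dj by simp
    finally have "\<bar>c\<bar> *\<^sub>R w \<le> g" .
    then have "inverse \<bar>c\<bar> *\<^sub>R (\<bar>c\<bar> *\<^sub>R w) \<le> inverse \<bar>c\<bar> *\<^sub>R g"
      by (intro scaleR_left_mono) auto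
    then have "\<bar>w\<bar> \<le> inverse \<bar>c\<bar> *\<^sub>R g" using False nn by simp
    then show ?thesis
      using g by (auto simp: generated_convex_l_subgroup_eq intro!: exI[of _ "inverse \<bar>c\<bar>"])
  qed
qed

text \<open>The sum of \<open>G(g)\<close> and the polar of \<open>g\<close> is a subspace
  containing the constancy set of \<open>g\<close>, hence all unital components, hence
  everything.\<close>

lemma simple_imp_hyperarchimedean:
  assumes "simple_trunc tr"
  shows "hyperarchimedean TYPE('a)"
proof (rule hyperarchimedeanI)
  fix g f :: 'a
  assume g: "0 \<le> g"
  let ?A = "generated_convex_l_subgroup g" and ?B = "polar g"
  have sub: "subspace ?A" "subspace ?B"
    using g subspace_generated_convex_l_subgroup subspace_polar by auto
  let ?D = "{x + y | x y. x \<in> ?A \<and> y \<in> ?B}"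
  have D: "subspace ?D" using subspace_sums[OF sub] .
  have "x \<in> ?D" if "x \<in> ?A" for x
    using that subspace_0[OF sub(2)] by (intro CollectI exI[of _ x] exI[of _ 0]) auto
  moreover have "x \<in> ?D" if "x \<in> ?B" for x
    using that subspace_0[OF sub(1)] by (intro CollectI exI[of _ 0] exI[of _ x]) auto
  ultimately have "constancy_set g \<subseteq> ?D"
    using constancy_set_generated_or_polar[OF g] by blast
  then have "span (constancy_set g) \<subseteq> ?D" using D by (rule span_minimal)
  moreover have "unital_components tr \<subseteq> span (constancy_set g)"
    using assms by (intro unital_components_in_span_constancy_set) (auto simp: simple_trunc_def)
  ultimately have "span (unital_components tr) \<subseteq> ?D"
    using D by (intro span_minimal) auto
  then have "f \<in> ?D" using assms by (auto simp: simple_trunc_def)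
  then show "\<exists>p\<in>?A. \<exists>q\<in>?B. f = p + q" by blast
qed

section \<open>From hyperarchimedean to simple\<close>

text \<open>Where \<open>h \<ominus> 1\<close> does not vanish, \<open>tr h\<close> is \<open>1\<close>, hence dominates every truncated element.\<close>

lemma trunc_range_minus_trunc_disjoint:
  assumes "0 \<le> h" "x \<in> trunc_range tr"
  shows "inf (sup (x - tr h) 0) (h - tr h) = 0"
proof -
  \<comment> \<open>After joining with \<open>tr h\<close>, the meet with \<open>h\<close> is
    exactly \<open>tr h\<close>; subtracting it from both sides makes them disjoint.\<close>
  let ?x = "sup x (tr h)"
  have x: "?x \<in> trunc_range tr" using assms trunc_range_sup trunc_in_trunc_range by auto
  have "inf h ?x \<le> tr h"
    using inf_trunc_le[of h ?x] assms(1) trunc_range_nonneg[OF x] trunc_range_fixed[OF x] by simp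
  then have "inf ?x h = tr h"
    using trunc_le[OF assms(1)] by (intro order.antisym) (auto simp: inf.commute)
  then have "inf (?x - tr h) (h - tr h) = 0"
    using disjoint_positive_parts[of ?x h] by simp
  moreover have "?x - tr h = sup (x - tr h) 0"
    using add_sup_distrib_right[of x "tr h" "- tr h"] by simp
  ultimately show ?thesis by simp
qed

text \<open>Let \<open>tr h = u + s\<close> with \<open>u\<close> the projection onto the convex
  subgroup of \<open>k = h - tr h\<close>. The excess of a truncated \<open>x\<close> over
  \<open>u\<close> is at most its excess over \<open>tr h\<close> plus \<open>s\<close>, both
  disjoint from \<open>k\<close> and so from \<open>u\<close>. As \<open>tr g\<close> is below
  \<open>tr h\<close> and disjoint from \<open>s\<close>, it is below \<open>u\<close>.\<close>

lemma bounded_away_imp_enough_unital_components: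
  assumes hyp: "hyperarchimedean TYPE('a)" and "bounded_away_from_infinity tr"
  shows "enough_unital_components tr"
  unfolding enough_unital_components_def
proof (intro allI impI)
  fix g :: 'a assume g: "0 \<le> g"
  then obtain h where h: "0 \<le> h" "tr g \<le> ominus_one tr h"
    using assms by (auto simp: bounded_away_from_infinity_def)
  define k where "k = h - tr h"
  have k: "0 \<le> k" "tr g \<le> k" "k \<le> h"
    using h trunc_le[OF h(1)] trunc_nonneg[OF h(1)] by (auto simp: k_def ominus_one_def)
  obtain u s c where us: "tr h = u + s" "0 \<le> u" "0 \<le> s" "0 \<le> c" "u \<le> c *\<^sub>R k" "inf s k = 0"
    "inf u s = 0"
    by (rule hyperarchimedean_projection[OF hyp k(1) trunc_nonneg[OF h(1)]])
  have "u \<in> unital_components tr"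
    unfolding unital_components_iff
  proof (intro conjI ballI)
    show "u \<in> trunc_range tr"
      using trunc_range_downward_closed[OF trunc_in_trunc_range[OF h(1)] us(2)] us(1,3) by simp
    fix x assume "x \<in> trunc_range tr"
    then have "inf k (sup (x - tr h) 0 + s) = 0"
      using trunc_range_minus_trunc_disjoint[OF h(1)] us(6)
      by (intro disjoint_add) (auto simp: k_def inf.commute)
    moreover have "sup (x - u) 0 \<le> sup (x - tr h) 0 + s"
      using us(1,3) by (auto simp: add_sup_distrib_right intro: le_supI2)
    ultimately have "inf k (sup (x - u) 0) = 0"
      by (elim disjoint_mono) (auto simp: k(1))
    from disjoint_scaleR[OF this us(4)] show "inf u (sup (x - u) 0) = 0"
      by (rule disjoint_mono) (auto simp: us(2,5))
  qed
  moreover have "tr g \<le> u"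
  proof -
    have nn: "0 \<le> tr g" using trunc_nonneg[OF g] .
    \<comment> \<open>Idempotence of the truncation turns \<open>tr g \<le> h\<close> into
      this.\<close>
    have "tr g \<le> tr h"
      using trunc_mono[OF nn, of h] trunc_range_fixed[OF trunc_in_trunc_range[OF g]] k by simp
    then have "tr g = inf (tr g) (u + s)" using us(1) by (simp add: inf_absorb1)
    also have "\<dots> \<le> inf (tr g) u + inf (tr g) s" using nn us(2,3) by (rule inf_add_le)
    also have "inf (tr g) s = 0"
      using disjoint_mono[OF us(6,3) order.refl nn k(2)] by (simp only: inf.commute)
    finally show ?thesis by simp
  qed
  ultimately show "\<exists>u\<in>unital_components tr. tr g \<le> u" by blast
qed

section \<open>From enough unital components to simple\<close>

lemma unital_bound:
  assumes hyp: "hyperarchimedean TYPE('a)" and u: "u \<in> unital_components tr"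
    and g: "0 \<le> g" "tr g \<le> u"
  obtains c where "0 \<le> c" "g \<le> c *\<^sub>R u"
proof -
  obtain p q c where pq: "g = p + q" "0 \<le> p" "0 \<le> q" "0 \<le> c" "p \<le> c *\<^sub>R u" "inf q u = 0"
    "inf p q = 0"
    by (rule hyperarchimedean_projection[OF hyp unital_components_nonneg[OF u] g(1)])
  \<comment> \<open>The part \<open>q\<close> of \<open>g\<close> off \<open>u\<close> has its
    truncation below both \<open>q\<close> and \<open>u\<close>, which are disjoint, so
    \<open>q\<close> vanishes.\<close>
  have "tr q \<le> tr g" using pq by (intro trunc_mono) auto
  then have "tr q \<le> inf q u" using g trunc_le[OF pq(3)] by auto
  then have "tr q = 0" using pq trunc_nonneg by (intro order.antisym) auto
  then have "q = 0" using trunc_eq_0 pq by blast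
  then show ?thesis using that pq by auto
qed

text \<open>The increment of \<open>\<phi>\<close> from \<open>0\<close> to \<open>c\<close> is
  \<open>g\<close>. Increments over adjacent intervals add up, so by compactness, in the form of
  \<open>Bolzano\<close>, it suffices that increments over short intervals around each point lie in
  the span.\<close>

lemma bounded_in_span:
  assumes hyp: "hyperarchimedean TYPE('a)" and u: "u \<in> unital_components tr"
    and g: "0 \<le> g" "g \<le> c *\<^sub>R u" and c: "0 \<le> c"
  shows "g \<in> span (unital_components tr)"
proof -
  let ?S = "span (unital_components tr)"
  define \<phi> where "\<phi> t = inf g (t *\<^sub>R u)" for t :: real
  have nn: "0 \<le> u" using u unital_components_nonneg by auto
  have "\<phi> c - \<phi> 0 \<in> ?S"
    using c
  proof (induction rule: Bolzano)
    case (trans r s t)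
    from span_add[OF this(1,2)] show ?case by simp
  next
    case (local r)
    obtain p \<delta> where p: "is_component p u" "0 < \<delta>"
      "\<And>d. 0 \<le> d \<Longrightarrow> d < \<delta> \<Longrightarrow> inf (sup (g - r *\<^sub>R u) 0) (d *\<^sub>R u) = d *\<^sub>R p"
      using hyperarchimedean_inf_small_multiple[OF hyp sup_ge2 nn] by metis
    obtain q \<epsilon> where q: "is_component q u" "0 < \<epsilon>"
      "\<And>d. 0 \<le> d \<Longrightarrow> d < \<epsilon> \<Longrightarrow> inf (sup (r *\<^sub>R u - g) 0) (d *\<^sub>R u) = d *\<^sub>R q"
      using hyperarchimedean_inf_small_multiple[OF hyp sup_ge2 nn] by metis
    have S: "u \<in> ?S" "p \<in> ?S" "q \<in> ?S"
      using u p(1) q(1) component_of_unital by (auto intro!: span_base)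
    \<comment> \<open>Split the interval at \<open>r\<close>: the slope is \<open>p\<close> to the
      right of \<open>r\<close> and \<open>u - q\<close> to the left.\<close>
    have "\<phi> t - \<phi> s \<in> ?S" if "s \<le> r \<and> r \<le> t \<and> t - s < min \<delta> \<epsilon>" for s t
    proof -
      have "\<phi> t - \<phi> r = (t - r) *\<^sub>R p"
        using inf_multiples_diff(1)[OF nn, of r t g] that p(3)[of "t - r"] by (simp add: \<phi>_def)
      moreover have "inf (sup (r *\<^sub>R u - g) 0) ((r - s) *\<^sub>R u) = (r - s) *\<^sub>R q"
        using that by (intro q(3)) auto
      then have "\<phi> r - \<phi> s = (r - s) *\<^sub>R u - (r - s) *\<^sub>R q"
        using inf_multiples_diff(2)[OF nn, of s r g] that by (simp only: \<phi>_def)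
      moreover have "\<phi> t - \<phi> s = (\<phi> t - \<phi> r) + (\<phi> r - \<phi> s)" by simp
      ultimately show ?thesis using S by (auto intro!: span_add span_diff span_scale)
    qed
    then show ?case using p(2) q(2) by (intro exI[of _ "min \<delta> \<epsilon>"]) auto
  qed
  moreover have "\<phi> c = g" "\<phi> 0 = 0" using g by (auto simp: \<phi>_def inf_absorb1 inf_absorb2)
  ultimately show ?thesis by simp
qed

lemma hyperarchimedean_enough_imp_simple:
  assumes hyp: "hyperarchimedean TYPE('a)" and "enough_unital_components tr"
  shows "simple_trunc tr"
  unfolding simple_trunc_def
proof
  fix f :: 'a
  have pos: "g \<in> span (unital_components tr)" if "0 \<le> g" for g
  proof -
    obtain u where u: "u \<in> unital_components tr" "tr g \<le> u"
      using assms(2) \<open>0 \<le> g\<close> by (auto simp: enough_unital_components_def)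
    obtain c where "0 \<le> c" "g \<le> c *\<^sub>R u"
      by (rule unital_bound[OF hyp u(1) \<open>0 \<le> g\<close> u(2)])
    then show ?thesis using bounded_in_span[OF hyp u(1) \<open>0 \<le> g\<close>] by blast
  qed
  have "f = sup f 0 - sup (- f) 0"
    using prts[of f] pprt_neg[of f] by (simp add: pprt_def)
  moreover have "sup f 0 - sup (- f) 0 \<in> span (unital_components tr)"
    by (intro span_diff pos sup_ge2)
  ultimately show "f \<in> span (unital_components tr)" by (simp only:)
qed

end

theorem theorem8p3p6:
  fixes tr :: "'a::archimedean_vector_lattice \<Rightarrow> 'a"
  assumes "truncation tr"
  shows "(hyperarchimedean TYPE('a) \<and> enough_unital_components tr \<longleftrightarrow>
          hyperarchimedean TYPE('a) \<and> bounded_away_from_infinity tr) \<and>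
         (hyperarchimedean TYPE('a) \<and> bounded_away_from_infinity tr \<longleftrightarrow> simple_trunc tr)"
proof -
  interpret truncation tr by (fact assms)
  show ?thesis
    using simple_imp_enough_unital_components simple_imp_hyperarchimedean
      enough_imp_bounded_away_from_infinity bounded_away_imp_enough_unital_components
      hyperarchimedean_enough_imp_simple by blast
qed

end
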